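(* For every finite simple graph $G$, \[ \chi(G) \,\leq\, \chi_\ell(G) \,\leq\, \chi_{DP}(G) \,\leq\, \chi_{DPP}(G) \,\leq\, \mathsf{wd}(G) + 1, \] where $\chi(G)$ is the chromatic number, $\chi_\ell(G)$ the list-chromatic number, $\chi_{DP}(G)$ the DP-chromatic number, $\chi_{DPP}(G)$ the DP-paint number, and $\mathsf{wd}(G)$ the weak degeneracy of $G$.
   Context: All graphs are finite and simple; $\mathbb{N}=\{0,1,2,\ldots\}$. List coloring: if each $u\in V(G)$ is given a list $L(u)$ of colors, a proper $L$-coloring is a function $\phi$ on $V(G)$ with $\phi(u)\in L(u)$ for all $u$ and $\phi(u)\neq\phi(v)$ for all $uv\in E(G)$. $\chi_\ell(G)$ is the minimum $k$ such that $G$ admits a proper $L$-coloring whenever $|L(u)|\geq k$ for all $u\in V(G)$. DP-coloring: each $u\in V(G)$ is given a list $L(u)$ of colors and each edge $uv\in E(G)$ is assigned a matching $C_{uv}$ (not necessarily perfect, possibly empty) from $L(u)$ to $L(v)$. A proper $(L,C)$-coloring is a function $\phi$ on $V(G)$ with $\phi(u)\in L(u)$ for all $u$ and $\phi(u)\phi(v)\notin C_{uv}$ for all $uv\in E(G)$. $\chi_{DP}(G)$ is the minimum $k$ such that $G$ admits a proper $(L,C)$-coloring whenever $|L(u)|\geq k$ for all $u\in V(G)$. DP-painting game: let $g\colon V(G)\to\mathbb{N}$. The DP-painting game on $(G,g)$ is played by Lister and Painter in rounds $0,1,2,\ldots$. At the start of Round $i$ there is a graph $G_i$, with $G_0=G$.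 Lister picks a list $L_i(u)$ of colors (possibly empty) for each $u\in V(G_i)$ and assigns to every edge $uv\in E(G_i)$ a matching $C_{i,uv}$ from $L_i(u)$ to $L_i(v)$ (not necessarily perfect, possibly empty). In response, Painter picks a function $\phi_i$ defined on some subset $U_i\subseteq V(G_i)$ such that $\phi_i(u)\in L_i(u)$ for all $u\in U_i$, and $\phi_i(u)\phi_i(v)\notin C_{i,uv}$ for all $u,v\in U_i$ adjacent in $G_i$. Then $G_{i+1}=G_i-U_i$ and the game proceeds to Round $i+1$. Lister wins if for some $i\in\mathbb{N}$ there is a vertex $u\in V(G_i)$ with $\sum_{j<i}|L_j(u)|\geq g(u)$; otherwise Painter wins. $G$ is $g$-DP-paintable if Painter has a winning strategy in the DP-painting game on $(G,g)$. $\chi_{DPP}(G)$ is the least $k\in\mathbb{N}$ such that $G$ is DP-paintable with respect to the constant $k$ function. Weak degeneracy: let $f\colon V(G)\to\mathbb{N}$. For a vertex $u$, the operation $\mathrm{Delete}(G,f,u)$ outputs $G'=G-u$ and $f'\colon V(G')\to\mathbb{Z}$ with $f'(v)=f(v)-1$ if $uv\in E(G)$ and $f'(v)=f(v)$ otherwise; its application is legal if $f'(v)\geq 0$ for all $v\in V(G')$. For adjacent vertices $u,w$, the operation $\mathrm{DelSave}(G,f,u,w)$ outputs $G'=G-u$ and $f'\colon V(G')\to\mathbb{Z}$ with $f'(v)=f(v)-1$ if $uv\in E(G)$ and $v\neq w$, and $f'(v)=f(v)$ otherwise; its application is legal if $f(u)>f(w)$ and $f'$ is non-negative. $G$ is weakly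 $f$-degenerate if all vertices of $G$ can be removed by a sequence of legal applications of Delete and DelSave, starting with $(G,f)$. For $d\in\mathbb{N}$, $G$ is weakly $d$-degenerate if it is weakly degenerate with respect to the constant $d$ function. $\mathsf{wd}(G)$ is the minimum $d$ such that $G$ is weakly $d$-degenerate. *)

theory Defs
  imports "Graph_Theory.Digraph_Component"
begin

text \<open>
  A finite simple graph is a finite, loop-free, symmetric digraph without parallel arcs (the locale
  \<^locale>\<open>graph\<close>), so an edge \<open>uv\<close> is a pair of opposite arcs and adjacency is
  \<open>u \<rightarrow>\<^bsub>G\<^esub> v\<close>. The null graph is admitted.

  Lists of colors are finite sets of natural numbers. Only finitely many colors occur in an
  assignment of finite lists to a finite graph, so the choice of the color type is immaterial.
\<close>

definition delete_verts :: "('a, 'b) pre_digraph \<Rightarrow> 'a set \<Rightarrow> ('a, 'b) pre_digraph" where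
  "delete_verts G U = G \<restriction> (verts G - U)"

definition proper_coloring :: "('a, 'b) pre_digraph \<Rightarrow> ('a \<Rightarrow> nat) \<Rightarrow> bool" where
  "proper_coloring G \<phi> \<longleftrightarrow> (\<forall>u v. u \<rightarrow>\<^bsub>G\<^esub> v \<longrightarrow> \<phi> u \<noteq> \<phi> v)"

definition chromatic_number :: "('a, 'b) pre_digraph \<Rightarrow> nat" where
  "chromatic_number G = (LEAST k. \<exists>\<phi>. proper_coloring G \<phi> \<and> \<phi> ` verts G \<subseteq> {..<k})"

definition proper_list_coloring ::
    "('a, 'b) pre_digraph \<Rightarrow> ('a \<Rightarrow> nat set) \<Rightarrow> ('a \<Rightarrow> nat) \<Rightarrow> bool" where
  "proper_list_coloring G L \<phi> \<longleftrightarrow> (\<forall>u\<in>verts G. \<phi> u \<in> L u) \<and> proper_coloring G \<phi>"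

definition list_chromatic_number :: "('a, 'b) pre_digraph \<Rightarrow> nat" where
  "list_chromatic_number G =
     (LEAST k. \<forall>L. (\<forall>u\<in>verts G. finite (L u) \<and> k \<le> card (L u)) \<longrightarrow>
        (\<exists>\<phi>. proper_list_coloring G L \<phi>))"


type_synonym 'a matchings = "'a \<Rightarrow> 'a \<Rightarrow> (nat \<times> nat) set"

definition matching :: "nat set \<Rightarrow> nat set \<Rightarrow> (nat \<times> nat) set \<Rightarrow> bool" where
  "matching A B M \<longleftrightarrow> M \<subseteq> A \<times> B \<and> single_valued M \<and> single_valued (M\<inverse>)"

text \<open>
  One matching is assigned to each undirected edge; the equation \<open>C v u = (C u v)\<inverse>\<close> says that the
  two orientations of an edge carry the same matching.
\<close>

definition dp_cover :: "('a, 'b) pre_digraph \<Rightarrow> ('a \<Rightarrow> nat set) \<Rightarrow> 'a matchings \<Rightarrow> bool" where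
  "dp_cover G L C \<longleftrightarrow>
     (\<forall>u\<in>verts G. finite (L u)) \<and>
     (\<forall>u v. u \<rightarrow>\<^bsub>G\<^esub> v \<longrightarrow> matching (L u) (L v) (C u v) \<and> C v u = (C u v)\<inverse>)"

definition proper_dp_coloring ::
    "('a, 'b) pre_digraph \<Rightarrow> ('a \<Rightarrow> nat set) \<Rightarrow> 'a matchings \<Rightarrow> ('a \<Rightarrow> nat) \<Rightarrow> bool" where
  "proper_dp_coloring G L C \<phi> \<longleftrightarrow>
     (\<forall>u\<in>verts G. \<phi> u \<in> L u) \<and> (\<forall>u v. u \<rightarrow>\<^bsub>G\<^esub> v \<longrightarrow> (\<phi> u, \<phi> v) \<notin> C u v)"

definition dp_chromatic_number :: "('a, 'b) pre_digraph \<Rightarrow> nat" where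
  "dp_chromatic_number G =
     (LEAST k. \<forall>L C. dp_cover G L C \<and> (\<forall>u\<in>verts G. k \<le> card (L u)) \<longrightarrow>
        (\<exists>\<phi>. proper_dp_coloring G L C \<phi>))"


text \<open>
  A move of Lister is a pair \<open>(L, C)\<close>. A move of Painter is a partial function \<open>\<phi>\<close> whose domain is
  the set \<open>U\<close> of vertices colored in that round.
\<close>

type_synonym 'a lister_move = "('a \<Rightarrow> nat set) \<times> 'a matchings"

definition legal_lister_move :: "('a, 'b) pre_digraph \<Rightarrow> 'a lister_move \<Rightarrow> bool" where
  "legal_lister_move G m \<longleftrightarrow> dp_cover G (fst m) (snd m)"

definition legal_painter_move ::
    "('a, 'b) pre_digraph \<Rightarrow> 'a lister_move \<Rightarrow> ('a \<rightharpoonup> nat) \<Rightarrow> bool" where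
  "legal_painter_move G m \<phi> \<longleftrightarrow>
     dom \<phi> \<subseteq> verts G \<and>
     (\<forall>u c. \<phi> u = Some c \<longrightarrow> c \<in> fst m u) \<and>
     (\<forall>u v c d. \<phi> u = Some c \<and> \<phi> v = Some d \<and> u \<rightarrow>\<^bsub>G\<^esub> v \<longrightarrow> (c, d) \<notin> snd m u v)"

primrec game_graph :: "('a, 'b) pre_digraph \<Rightarrow> (nat \<Rightarrow> ('a \<rightharpoonup> nat)) \<Rightarrow> nat \<Rightarrow> ('a, 'b) pre_digraph" where
  "game_graph G \<phi> 0 = G"
| "game_graph G \<phi> (Suc i) = delete_verts (game_graph G \<phi> i) (dom (\<phi> i))"

definition lister_wins ::
    "('a, 'b) pre_digraph \<Rightarrow> ('a \<Rightarrow> nat) \<Rightarrow> (nat \<Rightarrow> 'a lister_move) \<Rightarrow> (nat \<Rightarrow> ('a \<rightharpoonup> nat)) \<Rightarrow> bool" where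
  "lister_wins G g m \<phi> \<longleftrightarrow>
     (\<exists>i. \<exists>u\<in>verts (game_graph G \<phi> i). (\<Sum>j<i. card (fst (m j) u)) \<ge> g u)"

text \<open>
  A strategy of Painter maps the list \<open>[m 0, \<dots>, m i]\<close> of Lister's moves so far to Painter's reply in
  Round \<open>i\<close>; Painter's own earlier moves are determined by the strategy and Lister's earlier moves.
  It is winning if, however Lister plays legally, all replies are legal and Lister does not win.
  Quantifying over infinite sequences of Lister's moves loses nothing, since Lister can always
  continue with empty lists.
\<close>

type_synonym 'a painter_strategy = "'a lister_move list \<Rightarrow> ('a \<rightharpoonup> nat)"

definition replies :: "'a painter_strategy \<Rightarrow> (nat \<Rightarrow> 'a lister_move) \<Rightarrow> nat \<Rightarrow> ('a \<rightharpoonup> nat)" where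
  "replies \<sigma> m i = \<sigma> (map m [0..<Suc i])"

definition painter_winning_strategy ::
    "('a, 'b) pre_digraph \<Rightarrow> ('a \<Rightarrow> nat) \<Rightarrow> 'a painter_strategy \<Rightarrow> bool" where
  "painter_winning_strategy G g \<sigma> \<longleftrightarrow>
     (\<forall>m. (\<forall>i. legal_lister_move (game_graph G (replies \<sigma> m) i) (m i)) \<longrightarrow>
        (\<forall>i. legal_painter_move (game_graph G (replies \<sigma> m) i) (m i) (replies \<sigma> m i)) \<and>
        \<not> lister_wins G g m (replies \<sigma> m))"

definition dp_paintable :: "('a, 'b) pre_digraph \<Rightarrow> ('a \<Rightarrow> nat) \<Rightarrow> bool" where
  "dp_paintable G g \<longleftrightarrow> (\<exists>\<sigma>. painter_winning_strategy G g \<sigma>)"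

definition dp_paint_number :: "('a, 'b) pre_digraph \<Rightarrow> nat" where
  "dp_paint_number G = (LEAST k. dp_paintable G (\<lambda>_. k))"


definition Delete ::
    "('a, 'b) pre_digraph \<Rightarrow> ('a \<Rightarrow> int) \<Rightarrow> 'a \<Rightarrow> ('a, 'b) pre_digraph \<times> ('a \<Rightarrow> int)" where
  "Delete G f u = (delete_verts G {u}, \<lambda>v. if u \<rightarrow>\<^bsub>G\<^esub> v then f v - 1 else f v)"

definition DelSave ::
    "('a, 'b) pre_digraph \<Rightarrow> ('a \<Rightarrow> int) \<Rightarrow> 'a \<Rightarrow> 'a \<Rightarrow> ('a, 'b) pre_digraph \<times> ('a \<Rightarrow> int)" where
  "DelSave G f u w = (delete_verts G {u}, \<lambda>v. if u \<rightarrow>\<^bsub>G\<^esub> v \<and> v \<noteq> w then f v - 1 else f v)"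

inductive legal_step ::
    "('a, 'b) pre_digraph \<times> ('a \<Rightarrow> int) \<Rightarrow> ('a, 'b) pre_digraph \<times> ('a \<Rightarrow> int) \<Rightarrow> bool" where
  Delete: "\<lbrakk>u \<in> verts G; Delete G f u = (G', f'); \<forall>v\<in>verts G'. f' v \<ge> 0\<rbrakk>
     \<Longrightarrow> legal_step (G, f) (G', f')"
| DelSave: "\<lbrakk>u \<rightarrow>\<^bsub>G\<^esub> w; DelSave G f u w = (G', f'); f u > f w; \<forall>v\<in>verts G'. f' v \<ge> 0\<rbrakk>
     \<Longrightarrow> legal_step (G, f) (G', f')"

definition weakly_degenerate :: "('a, 'b) pre_digraph \<Rightarrow> ('a \<Rightarrow> nat) \<Rightarrow> bool" where
  "weakly_degenerate G f \<longleftrightarrow>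
     (\<exists>G' f'. legal_step\<^sup>*\<^sup>* (G, \<lambda>v. int (f v)) (G', f') \<and> verts G' = {})"

definition weak_degeneracy :: "('a, 'b) pre_digraph \<Rightarrow> nat" where
  "weak_degeneracy G = (LEAST d. weakly_degenerate G (\<lambda>_. d))"

end

theory Submission
  imports Defs
begin

text \<open>
  The first three inequalities hold because each parameter quantifies over more general instances
  than the one before: ordinary coloring with \<open>k\<close> colors is list coloring from the constant list
  \<open>{..<k}\<close>; list coloring is DP-coloring where the matching on an edge joins equal colors; and
  DP-coloring is the DP-painting game in which Lister offers everything in Round 0 and nothing
  afterwards. In that game every vertex has exhausted its allowance after Round 0, so a Painter who
  survives must have colored the whole graph at once.

  The substance is the last inequality. Read \<open>f v\<close> as the number of colors that Lister may still
  offer at \<open>v\<close> without winning. Painter keeps the uncolored graph weakly degenerate for the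
  current \<open>f\<close>; since the functions along a removal sequence are nonnegative, Lister never wins.
  That this can be maintained is \<open>painter_keeps_removable\<close>, by induction on the removal
  sequence. Let \<open>u\<close> be the vertex removed first. If Painter colors \<open>u\<close> with \<open>c\<close>, each neighbor loses
  at most the one color matched to \<open>c\<close>, which is paid for by the unit that the removal of \<open>u\<close>
  subtracts from \<open>f\<close> at that neighbor. If \<open>u\<close> was removed by DelSave for the benefit of \<open>w\<close>, then
  \<open>f\<close> is not lowered at \<open>w\<close>, so Painter wants a \<open>c\<close> without a partner in \<open>L w\<close>. If no such \<open>c\<close>
  exists, then \<open>L u\<close> injects into \<open>L w\<close>, hence the strict inequality between \<open>f u\<close> and \<open>f w\<close>
  survives the subtraction of the list sizes, and \<open>u\<close> may stay uncolored, to be removed first again in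
  the next round. Should \<open>w\<close> get colored in this round, the inequality is of no use; but Painter may
  ignore all except \<open>f w + 1\<close> colors of \<open>L w\<close>, so \<open>L u\<close> has at most \<open>f w + 1 \<le> f u\<close> colors and
  \<open>u\<close> can still be removed by Delete.

  All five minima are attained, since a graph on \<open>n\<close> vertices is weakly \<open>n\<close>-degenerate and
  every other bound follows from that one along the chain.
\<close>

section \<open>Removal sequences inside a fixed graph\<close>

text \<open>
  Weak degeneracy in a form that suits induction: the ambient adjacency relation \<open>E\<close> stays fixed and
  only the set \<open>S\<close> of remaining vertices shrinks. Demanding \<open>f u \<ge> 0\<close> of the removed vertex alone
  makes \<open>f\<close> nonnegative on all of \<open>S\<close>, because the function only decreases until a vertex is removed.
\<close>

inductive removable :: "('a \<Rightarrow> 'a \<Rightarrow> bool) \<Rightarrow> 'a set \<Rightarrow> ('a \<Rightarrow> int) \<Rightarrow> bool" for E where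
  empty: "removable E {} f"
| delete: "\<lbrakk>u \<in> S; 0 \<le> f u; removable E (S - {u}) (\<lambda>v. if E u v then f v - 1 else f v)\<rbrakk>
     \<Longrightarrow> removable E S f"
| del_save: "\<lbrakk>u \<in> S; w \<in> S - {u}; E u w; f w < f u;
      removable E (S - {u}) (\<lambda>v. if E u v \<and> v \<noteq> w then f v - 1 else f v)\<rbrakk>
     \<Longrightarrow> removable E S f"

lemma removable_nonneg: "removable E S f \<Longrightarrow> v \<in> S \<Longrightarrow> 0 \<le> f v"
proof (induction arbitrary: v rule: removable.induct)
  case (empty f)
  then show ?case by simp
next
  case (delete u S f)
  show ?case
  proof (cases "v = u")
    case False
    then have "v \<in> S - {u}" using delete.prems by simp
    from delete.IH[OF this] show ?thesis by (auto split: if_splits)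
  qed (use delete in simp)
next
  case (del_save u S w f)
  have "0 \<le> f w" using del_save.IH[OF del_save.hyps(2)] by simp
  show ?case
  proof (cases "v = u")
    case True
    then show ?thesis using \<open>0 \<le> f w\<close> del_save.hyps(4) by simp
  next
    case False
    then have "v \<in> S - {u}" using del_save.prems by simp
    from del_save.IH[OF this] show ?thesis by (auto split: if_splits)
  qed
qed

text \<open>
  The only delicate point is that raising \<open>f\<close> can destroy the inequality that DelSave needs. But
  then the raise at \<open>w\<close> is so large that \<open>w\<close> can afford the unit that Delete costs it.
\<close>

lemma removable_mono: "removable E S f \<Longrightarrow> (\<And>v. v \<in> S \<Longrightarrow> f v \<le> g v) \<Longrightarrow> removable E S g"
proof (induction arbitrary: g rule: removable.induct)
  case (empty f)
  show ?case by (rule removable.empty)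
next
  case (delete u S f)
  show ?case
  proof (rule removable.delete)
    show "u \<in> S" by fact
    show "0 \<le> g u" using delete.hyps delete.prems[of u] by simp
    show "removable E (S - {u}) (\<lambda>v. if E u v then g v - 1 else g v)"
      by (rule delete.IH) (use delete.prems in \<open>force split: if_splits\<close>)
  qed
next
  case (del_save u S w f)
  have fw: "0 \<le> f w" using removable_nonneg[OF del_save.hyps(5,2)] by simp
  have fu: "f u \<le> g u" using del_save.prems del_save.hyps(1) by simp
  show ?case
  proof (cases "g w < g u")
    case True
    show ?thesis
    proof (rule removable.del_save)
      show "u \<in> S" "w \<in> S - {u}" "E u w" "g w < g u" by fact+
      show "removable E (S - {u}) (\<lambda>v. if E u v \<and> v \<noteq> w then g v - 1 else g v)"
        by (rule del_save.IH) (use del_save.prems in \<open>force split: if_splits\<close>)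
    qed
  next
    case False
    show ?thesis
    proof (rule removable.delete)
      show "u \<in> S" by fact
      show "0 \<le> g u" using fw fu del_save.hyps(4) by simp
      show "removable E (S - {u}) (\<lambda>v. if E u v then g v - 1 else g v)"
        by (rule del_save.IH)
          (use del_save.prems False fu del_save.hyps(4) in \<open>force split: if_splits\<close>)
    qed
  qed
qed

lemma verts_delete_verts [simp]: "verts (delete_verts G U) = verts G - U"
  by (simp add: delete_verts_def)

lemma dominates_delete_verts [simp]:
  "u \<rightarrow>\<^bsub>delete_verts G U\<^esub> v \<longleftrightarrow> u \<rightarrow>\<^bsub>G\<^esub> v \<and> u \<in> verts G - U \<and> v \<in> verts G - U"
  by (auto simp: delete_verts_def arcs_ends_conv)

text \<open>
  The current graph \<open>H\<close> of a removal sequence is the subgraph of \<open>E\<close> induced by its vertices, so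
  adjacency in \<open>H\<close> and \<open>E\<close> may differ only outside \<open>verts H\<close>, where the values of \<open>f\<close> are irrelevant.
\<close>

lemma legal_steps_imp_removable:
  assumes "legal_step\<^sup>*\<^sup>* X Y" and "verts (fst Y) = {}"
    and "\<And>u v. u \<rightarrow>\<^bsub>fst X\<^esub> v \<longleftrightarrow> E u v \<and> u \<in> verts (fst X) \<and> v \<in> verts (fst X)"
    and "\<And>u. \<not> E u u"
    and "\<forall>v\<in>verts (fst X). 0 \<le> snd X v"
  shows "removable E (verts (fst X)) (snd X)"
  using assms
proof (induction rule: converse_rtranclp_induct)
  case base
  then show ?case by (simp add: removable.empty)
next
  case (step X Z)
  note adj = step.prems(2)
  from step.hyps(1) show ?case
  proof (cases rule: legal_step.cases)
    case (Delete u H f H' f')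
    have H': "H' = delete_verts H {u}" and f': "f' = (\<lambda>v. if u \<rightarrow>\<^bsub>H\<^esub> v then f v - 1 else f v)"
      using Delete(4) by (simp_all add: Delete_def)
    have "removable E (verts H - {u}) f'"
      using step.IH[OF step.prems(1) _ step.prems(3)] adj Delete by (auto simp: H')
    then have "removable E (verts H - {u}) (\<lambda>v. if E u v then f v - 1 else f v)"
      by (rule removable_mono) (use adj Delete in \<open>auto simp: f'\<close>)
    then show ?thesis
      using Delete step.prems(4) by (auto intro: removable.delete)
  next
    case (DelSave H u w f H' f')
    have H': "H' = delete_verts H {u}"
      and f': "f' = (\<lambda>v. if u \<rightarrow>\<^bsub>H\<^esub> v \<and> v \<noteq> w then f v - 1 else f v)"
      using DelSave(4) by (simp_all add: DelSave_def)
    have uw: "u \<in> verts H" "w \<in> verts H - {u}" "E u w"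
      using adj[of u w] DelSave step.prems(3) by auto
    have "removable E (verts H - {u}) f'"
      using step.IH[OF step.prems(1) _ step.prems(3)] adj DelSave by (auto simp: H')
    then have "removable E (verts H - {u}) (\<lambda>v. if E u v \<and> v \<noteq> w then f v - 1 else f v)"
      by (rule removable_mono) (use adj DelSave uw in \<open>auto simp: f'\<close>)
    then show ?thesis
      using DelSave uw by (auto intro: removable.del_save)
  qed
qed

lemma weakly_degenerate_imp_removable:
  assumes "graph G" and "weakly_degenerate G f"
  shows "removable (\<lambda>u v. u \<rightarrow>\<^bsub>G\<^esub> v) (verts G) (\<lambda>v. int (f v))"
proof -
  interpret graph G by fact
  obtain G' f' where "legal_step\<^sup>*\<^sup>* (G, \<lambda>v. int (f v)) (G', f')" "verts G' = {}"
    using assms(2) by (auto simp: weakly_degenerate_def)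
  from legal_steps_imp_removable[OF this(1), of "\<lambda>u v. u \<rightarrow>\<^bsub>G\<^esub> v"] this(2) show ?thesis
    using adj_not_same adj_in_verts by fastforce
qed

text \<open>Deleting the vertices in any order costs each of them at most one unit per deletion.\<close>

lemma legal_steps_from_card_verts:
  assumes "finite (verts H)" and "\<forall>v\<in>verts H. int (card (verts H)) \<le> f v"
  shows "\<exists>H' f'. legal_step\<^sup>*\<^sup>* (H, f) (H', f') \<and> verts H' = {}"
  using assms
proof (induction "card (verts H)" arbitrary: H f)
  case 0
  then show ?case by auto
next
  case (Suc n)
  then obtain u where u: "u \<in> verts H" by (metis card_eq_SucD insertI1)
  define f1 where "f1 = (\<lambda>v. if u \<rightarrow>\<^bsub>H\<^esub> v then f v - 1 else f v)"
  have n: "n = card (verts (delete_verts H {u}))" using u Suc.prems Suc.hyps(2) by simp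
  have ge: "int n \<le> f1 v" if "v \<in> verts (delete_verts H {u})" for v
    using that Suc.prems(2) Suc.hyps(2) by (force simp: f1_def)
  have "legal_step (H, f) (delete_verts H {u}, f1)"
    by (rule legal_step.Delete[OF u]) (use ge in \<open>force simp: Delete_def f1_def\<close>)+
  moreover have "\<exists>H' f'. legal_step\<^sup>*\<^sup>* (delete_verts H {u}, f1) (H', f') \<and> verts H' = {}"
    by (rule Suc.hyps(1)[OF n]) (use Suc.prems ge n in auto)
  ultimately show ?case by (meson converse_rtranclp_into_rtranclp)
qed

lemma weakly_degenerate_weak_degeneracy:
  assumes "finite (verts G)"
  shows "weakly_degenerate G (\<lambda>_. weak_degeneracy G)"
  unfolding weak_degeneracy_def
proof (rule LeastI)
  show "weakly_degenerate G (\<lambda>_. card (verts G))"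
    unfolding weakly_degenerate_def using assms by (intro legal_steps_from_card_verts) auto
qed

section \<open>One round of the painting game\<close>

text \<open>
  The matchings are not confined to the offered lists, so that the lists can be shortened without
  touching the matchings.
\<close>

definition matchings_on :: "('a \<Rightarrow> 'a \<Rightarrow> bool) \<Rightarrow> 'a set \<Rightarrow> 'a matchings \<Rightarrow> bool" where
  "matchings_on E S C \<longleftrightarrow>
     (\<forall>u\<in>S. \<forall>v\<in>S. E u v \<longrightarrow> single_valued (C u v) \<and> C v u = (C u v)\<inverse>)"

lemma matchings_on_subset: "matchings_on E S C \<Longrightarrow> T \<subseteq> S \<Longrightarrow> matchings_on E T C"
  by (auto simp: matchings_on_def)

lemma matchings_onD:
  assumes "matchings_on E S C" and "u \<in> S" and "v \<in> S" and "E u v"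
  shows "single_valued (C u v)" and "C v u = (C u v)\<inverse>"
  using assms unfolding matchings_on_def by blast+

definition good_reply ::
    "('a \<Rightarrow> 'a \<Rightarrow> bool) \<Rightarrow> 'a matchings \<Rightarrow> 'a set \<Rightarrow> ('a \<Rightarrow> int) \<Rightarrow> ('a \<Rightarrow> nat set) \<Rightarrow> ('a \<rightharpoonup> nat) \<Rightarrow> bool"
  where
  "good_reply E C S f L \<phi> \<longleftrightarrow>
     dom \<phi> \<subseteq> S \<and> (\<forall>u c. \<phi> u = Some c \<longrightarrow> c \<in> L u) \<and>
     (\<forall>u v c d. \<phi> u = Some c \<and> \<phi> v = Some d \<and> E u v \<longrightarrow> (c, d) \<notin> C u v) \<and>
     removable E (S - dom \<phi>) (\<lambda>v. f v - int (card (L v)))"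

text \<open>
  A list need not be longer than \<open>f v + 1\<close>: if a vertex survives with a list of that
  length, its value has become negative, which a removable position excludes.
\<close>

lemma good_reply_shortened_lists:
  assumes "good_reply E C S f L' \<phi>"
    and "\<And>v. v \<in> S \<Longrightarrow> L' v \<subseteq> L v"
    and "\<And>v. v \<in> S \<Longrightarrow> card (L' v) = card (L v) \<or> f v < int (card (L' v))"
  shows "good_reply E C S f L \<phi>"
proof -
  have rem: "removable E (S - dom \<phi>) (\<lambda>v. f v - int (card (L' v)))"
    and dom: "dom \<phi> \<subseteq> S" using assms(1) by (auto simp: good_reply_def)
  have "removable E (S - dom \<phi>) (\<lambda>v. f v - int (card (L v)))"
    using rem
  proof (rule removable_mono)
    fix v assume v: "v \<in> S - dom \<phi>"
    then show "f v - int (card (L' v)) \<le> f v - int (card (L v))"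
      using removable_nonneg[OF rem v] assms(3)[of v] by auto
  qed
  then show ?thesis using assms(1,2) dom by (fastforce simp: good_reply_def)
qed

text \<open>
  Painter commits to color \<open>c\<close> at \<open>u\<close> and continues on the rest with the lists \<open>L'\<close> from which the
  partners of \<open>c\<close> have been struck out; \<open>f'\<close> is the function left after the removal of \<open>u\<close>.
\<close>

lemma good_reply_color:
  assumes "good_reply E C (S - {u}) f' L' \<phi>"
    and L': "L' = (\<lambda>v. if E u v then L v - C u v `` {c} else L v)"
    and "u \<in> S" and "c \<in> L u"
    and "irreflp E" and "symp E" and "matchings_on E S C"
    and "\<And>v. v \<in> S - {u} \<Longrightarrow> f' v - int (card (L' v)) \<le> f v - int (card (L v))"
  shows "good_reply E C S f L (\<phi>(u \<mapsto> c))"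
proof -
  have \<phi>: "dom \<phi> \<subseteq> S - {u}" "\<And>v d. \<phi> v = Some d \<Longrightarrow> d \<in> L' v"
    "\<And>v w d e. \<phi> v = Some d \<Longrightarrow> \<phi> w = Some e \<Longrightarrow> E v w \<Longrightarrow> (d, e) \<notin> C v w"
    and rem: "removable E (S - {u} - dom \<phi>) (\<lambda>v. f' v - int (card (L' v)))"
    using assms(1) by (auto simp: good_reply_def)
  have "removable E (S - {u} - dom \<phi>) (\<lambda>v. f v - int (card (L v)))"
    using rem by (rule removable_mono) (use assms(8) in auto)
  moreover have "S - dom (\<phi>(u \<mapsto> c)) = S - {u} - dom \<phi>" by auto
  ultimately have "removable E (S - dom (\<phi>(u \<mapsto> c))) (\<lambda>v. f v - int (card (L v)))" by simp
  moreover have "dom (\<phi>(u \<mapsto> c)) \<subseteq> S" using \<phi>(1) assms(3) by auto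
  moreover have "d \<in> L v" if "(\<phi>(u \<mapsto> c)) v = Some d" for v d
    using that \<phi>(2)[of v d] assms(4) by (auto simp: L' split: if_splits)
  moreover have "(d, e) \<notin> C v w"
    if d: "(\<phi>(u \<mapsto> c)) v = Some d" and e: "(\<phi>(u \<mapsto> c)) w = Some e" and "E v w" for v w d e
  proof -
    have free: "(c, a) \<notin> C u x" if "\<phi> x = Some a" "E u x" for x a
      using \<phi>(2)[OF that(1)] that(2) by (simp add: L')
    consider "v = u" "w \<noteq> u" | "v \<noteq> u" "w = u" | "v \<noteq> u" "w \<noteq> u"
      using irreflpD[OF assms(5)] \<open>E v w\<close> by blast
    then show ?thesis
    proof cases
      case 1
      then show ?thesis using free[of w e] d e \<open>E v w\<close> by simp
    next
      case 2
      have "v \<in> S" using \<phi>(1) d 2 by auto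
      moreover have "E u v" using sympD[OF assms(6)] \<open>E v w\<close> 2 by simp
      ultimately have "C v u = (C u v)\<inverse>" using matchings_onD(2)[OF assms(7,3)] by blast
      then show ?thesis using free[of v d] \<open>E u v\<close> d e 2 by simp
    next
      case 3
      then show ?thesis using \<phi>(3)[of v d w e] d e \<open>E v w\<close> by simp
    qed
  qed
  ultimately show ?thesis unfolding good_reply_def by blast
qed

lemma card_Diff_Image_singleton:
  assumes "finite A" and "single_valued M"
  shows "card A \<le> card (A - M `` {c}) + 1"
proof -
  have "A \<subseteq> insert (THE d. (c, d) \<in> M) (A - M `` {c})"
    using assms(2) by (auto simp: single_valued_def intro!: the_equality[symmetric])
  then have "card A \<le> card (insert (THE d. (c, d) \<in> M) (A - M `` {c}))"
    using assms(1) by (intro card_mono) auto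
  also have "\<dots> \<le> card (A - M `` {c}) + 1"
    using assms(1) by (simp add: card_insert_if)
  finally show ?thesis .
qed

lemma card_le_if_matched:
  assumes "single_valued (M\<inverse>)" and "finite B" and "\<And>c. c \<in> A \<Longrightarrow> \<exists>d\<in>B. (c, d) \<in> M"
  shows "card A \<le> card B"
proof -
  obtain p where p: "\<And>c. c \<in> A \<Longrightarrow> p c \<in> B \<and> (c, p c) \<in> M" using assms(3) by metis
  then have "inj_on p A"
    using assms(1) unfolding single_valued_def inj_on_def by (metis converse_iff)
  then show ?thesis using p assms(2) by (intro card_inj_on_le) auto
qed

text \<open>
  The vertex \<open>u\<close> that is removed first is either colored, and then the rest is a smaller game with
  shorter lists, or left alone, and then its removal is put in front of the sequence obtained for the
  rest. The latter is safe only while \<open>f u\<close> minus the size of \<open>L u\<close> is nonnegative. So \<open>u\<close> is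
  colored whenever that does not harm the vertex \<open>w\<close> saved by the removal of \<open>u\<close>; when there is no
  such \<open>w\<close>, any color will do and \<open>u\<close> is left alone only if its list is empty.
\<close>

theorem painter_keeps_removable:
  assumes "removable E S f" and "matchings_on E S C" and "\<forall>v\<in>S. finite (L v)"
    and "irreflp E" and "symp E"
  shows "\<exists>\<phi>. good_reply E C S f L \<phi>"
  using assms
proof (induction arbitrary: L rule: removable.induct)
  case (empty f)
  have "good_reply E C {} f L Map.empty" by (simp add: good_reply_def removable.empty)
  then show ?case by blast
next
  case (delete u S f)
  let ?f' = "\<lambda>v. if E u v then f v - 1 else f v"
  have M': "matchings_on E (S - {u}) C" using delete.prems(1) by (rule matchings_on_subset) auto
  show ?case
  proof (cases "L u = {}")
    case True
    obtain \<phi> where \<phi>: "good_reply E C (S - {u}) ?f' L \<phi>"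
      using delete.IH[OF M' _ delete.prems(3-4), of L] delete.prems(2) by auto
    then have u: "u \<in> S - dom \<phi>" "S - {u} - dom \<phi> = S - dom \<phi> - {u}"
      using delete.hyps(1) by (auto simp: good_reply_def)
    have "removable E (S - dom \<phi>) (\<lambda>v. f v - int (card (L v)))"
    proof (rule removable.delete[OF u(1)])
      show "0 \<le> f u - int (card (L u))" using True delete.hyps(2) by simp
      have "removable E (S - dom \<phi> - {u}) (\<lambda>v. ?f' v - int (card (L v)))"
        using \<phi> u(2) by (simp add: good_reply_def)
      then show "removable E (S - dom \<phi> - {u})
          (\<lambda>v. if E u v then f v - int (card (L v)) - 1 else f v - int (card (L v)))"
        by (rule removable_mono) auto
    qed
    then have "good_reply E C S f L \<phi>" using \<phi> by (auto simp: good_reply_def)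
    then show ?thesis by blast
  next
    case False
    then obtain c where c: "c \<in> L u" by blast
    define L' where "L' = (\<lambda>v. if E u v then L v - C u v `` {c} else L v)"
    have fin': "\<forall>v\<in>S - {u}. finite (L' v)"
      using delete.prems(2) by (simp add: L'_def)
    obtain \<phi> where \<phi>: "good_reply E C (S - {u}) ?f' L' \<phi>"
      using delete.IH[OF M' fin' delete.prems(3,4)] by blast
    have "good_reply E C S f L (\<phi>(u \<mapsto> c))"
    proof (rule good_reply_color[OF \<phi> L'_def delete.hyps(1) c delete.prems(3,4,1)])
      fix v assume v: "v \<in> S - {u}"
      have "card (L v) \<le> card (L' v) + 1" if "E u v"
        using that v delete.prems(2) matchings_onD(1)[OF delete.prems(1) delete.hyps(1)]
          card_Diff_Image_singleton[of "L v" "C u v" c]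
        by (simp add: L'_def)
      then show "?f' v - int (card (L' v)) \<le> f v - int (card (L v))"
        by (auto simp: L'_def)
    qed
    then show ?thesis by blast
  qed
next
  case (del_save u S w f)
  let ?f' = "\<lambda>v. if E u v \<and> v \<noteq> w then f v - 1 else f v"
  have M': "matchings_on E (S - {u}) C" using del_save.prems(1) by (rule matchings_on_subset) auto
  have w: "w \<in> S" "w \<noteq> u" using del_save.hyps(2) by auto
  have fw: "0 \<le> f w" using removable_nonneg[OF del_save.hyps(5,2)] by simp
  (* Shortening the list of w bounds |L u| by f u when L u is matched into L w, so that u can
     be left uncolored even if w gets colored. *)
  have short: "\<exists>\<phi>. good_reply E C S f L \<phi>"
    if fin: "\<forall>v\<in>S. finite (L v)" and Lw: "int (card (L w)) \<le> f w + 1"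
    for L :: "'a \<Rightarrow> nat set"
  proof (cases "\<exists>c\<in>L u. L w \<inter> C u w `` {c} = {}")
    case True
    then obtain c where c: "c \<in> L u" "L w \<inter> C u w `` {c} = {}" by blast
    define L' where "L' = (\<lambda>v. if E u v then L v - C u v `` {c} else L v)"
    have fin': "\<forall>v\<in>S - {u}. finite (L' v)"
      using fin by (simp add: L'_def)
    obtain \<phi> where \<phi>: "good_reply E C (S - {u}) ?f' L' \<phi>"
      using del_save.IH[OF M' fin' del_save.prems(3,4)] by blast
    have "good_reply E C S f L (\<phi>(u \<mapsto> c))"
    proof (rule good_reply_color[OF \<phi> L'_def del_save.hyps(1) c(1) del_save.prems(3,4,1)])
      fix v assume v: "v \<in> S - {u}"
      have "L' w = L w" using c(2) by (auto simp: L'_def)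
      moreover have "card (L v) \<le> card (L' v) + 1" if "E u v"
        using that v fin matchings_onD(1)[OF del_save.prems(1) del_save.hyps(1)]
          card_Diff_Image_singleton[of "L v" "C u v" c]
        by (simp add: L'_def)
      ultimately show "?f' v - int (card (L' v)) \<le> f v - int (card (L v))"
        by (auto simp: L'_def)
    qed
    then show ?thesis by blast
  next
    case False
    note M = matchings_onD[OF del_save.prems(1)]
    have "single_valued ((C u w)\<inverse>)"
      using M(2)[OF del_save.hyps(1) w(1) del_save.hyps(3)]
        M(1)[OF w(1) del_save.hyps(1) sympD[OF del_save.prems(4) del_save.hyps(3)]] by simp
    then have le: "card (L u) \<le> card (L w)"
      by (rule card_le_if_matched) (use False fin w(1) in auto)
    obtain \<phi> where \<phi>: "good_reply E C (S - {u}) ?f' L \<phi>"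
      using del_save.IH[OF M' _ del_save.prems(3-4), of L] fin by auto
    then have u: "u \<in> S - dom \<phi>" "S - {u} - dom \<phi> = S - dom \<phi> - {u}"
      using del_save.hyps(1) by (auto simp: good_reply_def)
    have rem: "removable E (S - dom \<phi> - {u}) (\<lambda>v. ?f' v - int (card (L v)))"
      using \<phi> u(2) by (simp add: good_reply_def)
    have "removable E (S - dom \<phi>) (\<lambda>v. f v - int (card (L v)))"
    proof (cases "w \<in> dom \<phi>")
      case True
      show ?thesis
      proof (rule removable.delete[OF u(1)])
        show "0 \<le> f u - int (card (L u))" using le Lw del_save.hyps(4) by simp
        show "removable E (S - dom \<phi> - {u})
            (\<lambda>v. if E u v then f v - int (card (L v)) - 1 else f v - int (card (L v)))"
          using rem by (rule removable_mono) (use True in auto)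
      qed
    next
      case False
      show ?thesis
      proof (rule removable.del_save)
        show "u \<in> S - dom \<phi>" "E u w" by fact+
        show "w \<in> S - dom \<phi> - {u}" using w False by auto
        show "f w - int (card (L w)) < f u - int (card (L u))" using le del_save.hyps(4) by simp
        show "removable E (S - dom \<phi> - {u})
            (\<lambda>v. if E u v \<and> v \<noteq> w then f v - int (card (L v)) - 1 else f v - int (card (L v)))"
          using rem by (rule removable_mono) auto
      qed
    qed
    then have "good_reply E C S f L \<phi>" using \<phi> by (auto simp: good_reply_def)
    then show ?thesis by blast
  qed
  obtain T where T: "T \<subseteq> L w" "card T = min (card (L w)) (nat (f w + 1))"
    by (meson min.cobounded1 obtain_subset_with_card_n)
  have "\<forall>v\<in>S. finite ((L(w := T)) v)"
    using T(1) del_save.prems(2) by (auto intro: finite_subset)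
  moreover have "int (card ((L(w := T)) w)) \<le> f w + 1" using T(2) fw by simp
  ultimately obtain \<phi> where \<phi>: "good_reply E C S f (L(w := T)) \<phi>" using short by blast
  have "good_reply E C S f L \<phi>"
    by (rule good_reply_shortened_lists[OF \<phi>]) (use T in \<open>auto simp: min_def\<close>)
  then show ?case by blast
qed

section \<open>Painter's strategy\<close>

lemma dominates_game_graph:
  assumes "wf_digraph G"
  shows "u \<rightarrow>\<^bsub>game_graph G \<phi> i\<^esub> v \<longleftrightarrow>
           u \<rightarrow>\<^bsub>G\<^esub> v \<and> u \<in> verts (game_graph G \<phi> i) \<and> v \<in> verts (game_graph G \<phi> i)"
  by (induction i) (use assms in \<open>auto intro: wf_digraph.adj_in_verts\<close>)

text \<open>
  A strategy sees only Lister's moves, so Painter recovers the position by replaying the game from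
  the start with the good replies. Removability of the position is the invariant: it supplies the next
  good reply, and its nonnegativity says that no uncolored vertex has exhausted its allowance.
\<close>

theorem weakly_degenerate_imp_dp_paintable:
  assumes "graph G" and "weakly_degenerate G f"
  shows "dp_paintable G (\<lambda>v. f v + 1)"
proof -
  interpret graph G by fact
  define E where "E = (\<lambda>u v. u \<rightarrow>\<^bsub>G\<^esub> v)"
  have irrefl: "irreflp E" by (auto simp: E_def irreflp_def dest: adj_not_same)
  have sym: "symp E" by (auto simp: E_def symp_def intro: arcs_ends_symmetric)
  have "\<exists>\<phi>. removable E S h \<and> matchings_on E S (snd m) \<and> (\<forall>v\<in>S. finite (fst m v)) \<longrightarrow>
      good_reply E (snd m) S h (fst m) \<phi>" for S h and m :: "'a lister_move"
    using painter_keeps_removable[of E S h "snd m" "fst m"] irrefl sym by blast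
  then obtain reply where reply:
    "\<And>S h m. \<lbrakk>removable E S h; matchings_on E S (snd m); \<forall>v\<in>S. finite (fst m v)\<rbrakk> \<Longrightarrow>
      good_reply E (snd m) S h (fst m) (reply S h m)"
    by metis
  (* A position consists of the uncolored vertices and the allowance left at each of them. *)
  define advance where "advance = (\<lambda>(S, h) m :: 'a lister_move.
    (S - dom (reply S h m), \<lambda>v. h v - int (card (fst m v))))"
  define pos where "pos = foldl advance (verts G, \<lambda>v. int (f v))"
  define \<sigma> where "\<sigma> = (\<lambda>ms. case pos (butlast ms) of (S, h) \<Rightarrow> reply S h (last ms))"
  have "painter_winning_strategy G (\<lambda>v. f v + 1) \<sigma>"
    unfolding painter_winning_strategy_def
  proof (intro allI impI)
    fix m :: "nat \<Rightarrow> 'a lister_move"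
    let ?H = "game_graph G (replies \<sigma> m)"
    define h where "h = (\<lambda>i v. int (f v) - (\<Sum>j<i. int (card (fst (m j) v))))"
    assume legal: "\<forall>i. legal_lister_move (?H i) (m i)"
    have \<sigma>: "replies \<sigma> m i = reply (verts (?H i)) (h i) (m i)"
      if "pos (map m [0..<i]) = (verts (?H i), h i)" for i
      using that by (simp add: replies_def \<sigma>_def)
    have good: "good_reply E (snd (m i)) (verts (?H i)) (h i) (fst (m i)) (replies \<sigma> m i)"
      if "pos (map m [0..<i]) = (verts (?H i), h i)" and "removable E (verts (?H i)) (h i)" for i
    proof -
      have "matchings_on E (verts (?H i)) (snd (m i))" "\<forall>v\<in>verts (?H i). finite (fst (m i) v)"
        using legal[rule_format, of i] dominates_game_graph[OF wf_digraph_axioms]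
        by (auto simp: legal_lister_move_def dp_cover_def matchings_on_def matching_def E_def)
      then show ?thesis using reply[OF that(2)] \<sigma>[OF that(1)] by simp
    qed
    have inv: "pos (map m [0..<i]) = (verts (?H i), h i) \<and> removable E (verts (?H i)) (h i)" for i
    proof (induction i)
      case 0
      then show ?case
        using weakly_degenerate_imp_removable[OF assms] by (simp add: pos_def h_def E_def)
    next
      case (Suc i)
      have h: "h (Suc i) = (\<lambda>v. h i v - int (card (fst (m i) v)))" by (simp add: h_def diff_diff_add)
      have "pos (map m [0..<Suc i]) = advance (verts (?H i), h i) (m i)"
        using Suc by (simp add: pos_def)
      also have "\<dots> = (verts (?H (Suc i)), h (Suc i))"
        using \<sigma> Suc by (simp add: advance_def h)
      finally show ?case
        using good[of i] Suc by (auto simp: good_reply_def h)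
    qed
    have "legal_painter_move (?H i) (m i) (replies \<sigma> m i)" for i
      using good[of i] inv[of i] dominates_game_graph[OF wf_digraph_axioms]
      by (auto simp: good_reply_def legal_painter_move_def E_def)
    moreover have "(\<Sum>j<i. card (fst (m j) u)) < f u + 1" if "u \<in> verts (?H i)" for i u
    proof -
      have "0 \<le> h i u" using inv[of i] that by (auto intro: removable_nonneg)
      then have "int (\<Sum>j<i. card (fst (m j) u)) < int (f u + 1)" by (simp add: h_def)
      then show ?thesis by (simp only: of_nat_less_iff)
    qed
    ultimately show "(\<forall>i. legal_painter_move (?H i) (m i) (replies \<sigma> m i)) \<and>
        \<not> lister_wins G (\<lambda>v. f v + 1) m (replies \<sigma> m)"
      by (force simp: lister_wins_def)
  qed
  then show ?thesis by (auto simp: dp_paintable_def)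
qed

section \<open>The chain of inequalities\<close>

lemma dp_paintable_imp_dp_coloring:
  assumes "wf_digraph G" and "dp_paintable G (\<lambda>_. k)"
    and "dp_cover G L C" and "\<forall>u\<in>verts G. k \<le> card (L u)"
  shows "\<exists>\<phi>. proper_dp_coloring G L C \<phi>"
proof -
  obtain \<sigma> where \<sigma>: "painter_winning_strategy G (\<lambda>_. k) \<sigma>"
    using assms(2) by (auto simp: dp_paintable_def)
  define m :: "nat \<Rightarrow> 'a lister_move"
    where "m = (\<lambda>i. if i = 0 then (L, C) else (\<lambda>_. {}, \<lambda>_ _. {}))"
  let ?\<phi> = "replies \<sigma> m"
  have "\<forall>i. legal_lister_move (game_graph G ?\<phi> i) (m i)"
    using assms(3) by (auto simp: m_def legal_lister_move_def dp_cover_def matching_def)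
  then have painter: "\<And>i. legal_painter_move (game_graph G ?\<phi> i) (m i) (?\<phi> i)"
    and not_lost: "\<not> lister_wins G (\<lambda>_. k) m ?\<phi>"
    using \<sigma> by (auto simp: painter_winning_strategy_def)
  have legal: "legal_painter_move G (L, C) (?\<phi> 0)"
    using painter[of 0] by (simp add: m_def)
  (* Everything is at stake in Round 0: a vertex left uncolored would make Lister win in Round 1. *)
  have "u \<in> dom (?\<phi> 0)" if "u \<in> verts G" for u
  proof (rule ccontr)
    assume "u \<notin> dom (?\<phi> 0)"
    then have "u \<in> verts (game_graph G ?\<phi> 1)" using that by simp
    moreover have "k \<le> (\<Sum>j<1. card (fst (m j) u))" using assms(4) that by (simp add: m_def)
    ultimately show False using not_lost unfolding lister_wins_def by blast
  qed
  then have colored: "?\<phi> 0 u = Some (the (?\<phi> 0 u))" if "u \<in> verts G" for u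
    using that by fastforce
  have "proper_dp_coloring G L C (\<lambda>u. the (?\<phi> 0 u))"
    unfolding proper_dp_coloring_def
  proof (intro conjI ballI allI impI)
    fix u assume "u \<in> verts G"
    then show "the (?\<phi> 0 u) \<in> L u" using legal colored by (auto simp: legal_painter_move_def)
  next
    fix u v assume uv: "u \<rightarrow>\<^bsub>G\<^esub> v"
    then have "u \<in> verts G" "v \<in> verts G" using assms(1) by (auto dest: wf_digraph.adj_in_verts)
    then show "(the (?\<phi> 0 u), the (?\<phi> 0 v)) \<notin> C u v"
      using legal colored uv unfolding legal_painter_move_def by auto
  qed
  then show ?thesis by blast
qed

text \<open>Joining equal colors turns a proper DP-coloring into a proper list coloring.\<close>

lemma dp_coloring_imp_list_coloring:
  assumes "\<And>C. dp_cover G L C \<Longrightarrow> \<exists>\<phi>. proper_dp_coloring G L C \<phi>"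
    and "wf_digraph G" and "\<forall>u\<in>verts G. finite (L u)"
  shows "\<exists>\<phi>. proper_list_coloring G L \<phi>"
proof -
  define C :: "'a matchings" where "C = (\<lambda>u v. {(c, c) | c. c \<in> L u \<inter> L v})"
  have "dp_cover G L C"
    using assms(3) by (auto simp: dp_cover_def matching_def C_def single_valued_def)
  then obtain \<phi> where \<phi>: "proper_dp_coloring G L C \<phi>" using assms(1) by blast
  have "\<phi> u \<noteq> \<phi> v" if uv: "u \<rightarrow>\<^bsub>G\<^esub> v" for u v
  proof -
    have "\<phi> u \<in> L u" "\<phi> v \<in> L v" "(\<phi> u, \<phi> v) \<notin> C u v"
      using \<phi> uv wf_digraph.adj_in_verts[OF assms(2) uv] by (auto simp: proper_dp_coloring_def)
    then show ?thesis by (auto simp: C_def)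
  qed
  then have "proper_list_coloring G L \<phi>"
    using \<phi> by (auto simp: proper_dp_coloring_def proper_list_coloring_def proper_coloring_def)
  then show ?thesis by blast
qed

theorem proposition1p3:
  fixes G :: "('a, 'b) pre_digraph"
  assumes "graph G"
  shows "chromatic_number G \<le> list_chromatic_number G \<and>
         list_chromatic_number G \<le> dp_chromatic_number G \<and>
         dp_chromatic_number G \<le> dp_paint_number G \<and>
         dp_paint_number G \<le> weak_degeneracy G + 1"
proof -
  interpret graph G by fact
  let ?choosable = "\<lambda>k. \<forall>L. (\<forall>u\<in>verts G. finite (L u) \<and> k \<le> card (L u)) \<longrightarrow>
    (\<exists>\<phi>. proper_list_coloring G L \<phi>)"
  let ?dp_colorable = "\<lambda>k. \<forall>L C. dp_cover G L C \<and> (\<forall>u\<in>verts G. k \<le> card (L u)) \<longrightarrow>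
    (\<exists>\<phi>. proper_dp_coloring G L C \<phi>)"
  have "dp_paintable G (\<lambda>_. weak_degeneracy G + 1)"
    using weakly_degenerate_imp_dp_paintable[OF assms weakly_degenerate_weak_degeneracy] by simp
  then have paint_le: "dp_paint_number G \<le> weak_degeneracy G + 1"
    and "dp_paintable G (\<lambda>_. dp_paint_number G)"
    unfolding dp_paint_number_def by (rule Least_le, rule LeastI)
  then have "?dp_colorable (dp_paint_number G)"
    using dp_paintable_imp_dp_coloring wf_digraph_axioms by blast
  then have dp_le: "dp_chromatic_number G \<le> dp_paint_number G"
    and dp: "?dp_colorable (dp_chromatic_number G)"
    unfolding dp_chromatic_number_def by (rule Least_le, rule LeastI)
  have "?choosable (dp_chromatic_number G)"
    using dp by (blast intro: dp_coloring_imp_list_coloring wf_digraph_axioms)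
  then have list_le: "list_chromatic_number G \<le> dp_chromatic_number G"
    and list: "?choosable (list_chromatic_number G)"
    unfolding list_chromatic_number_def by (rule Least_le, rule LeastI)
  obtain \<phi> where "proper_list_coloring G (\<lambda>_. {..<list_chromatic_number G}) \<phi>"
    using list[rule_format, of "\<lambda>_. {..<list_chromatic_number G}"] by auto
  then have "chromatic_number G \<le> list_chromatic_number G"
    unfolding chromatic_number_def
    by (intro Least_le exI[of _ \<phi>]) (auto simp: proper_list_coloring_def)
  with list_le dp_le paint_le show ?thesis by blast
qed

end
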